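(* Let $G$ be a connected simple graph with $n\ge 2$ vertices $v_1,\dots,v_n$. Then for every vertex $v_i$ of $G$, $$\mathcal{RE}_G(v_i)\leq\frac{3}{8}+\frac{3}{4}\,\frac{1}{d_i}\sum_{j:\, v_j\sim v_i}\frac{1}{d_j}-\frac{1}{8}\sum_{j=1}^n\frac{1}{d_id_j}\left(\sum_{k:\, v_k\sim v_i,\ v_k\sim v_j}\frac{1}{d_k}\right)^2.$$
   Context: All graphs are finite and simple. For a graph $G$ with vertices $v_1,\dots,v_n$, let $d_i$ be the degree of $v_i$; $v_j\sim v_i$ means that $v_j$ and $v_i$ are adjacent. The innermost sum in the last term runs over all common neighbours $v_k$ of $v_i$ and $v_j$ (for $j=i$, over all neighbours of $v_i$); an empty sum is $0$. The Randić matrix $R(G)=(R_{ij})$ is the real symmetric $n\times n$ matrix with $R_{ij}=\frac{1}{\sqrt{d_id_j}}$ if $v_i\sim v_j$ and $R_{ij}=0$ otherwise. Put $|R(G)|=(R(G)R(G)^* )^{1/2}$ (positive semidefinite square root). The Randić energy of the vertex $v_i$ is $\mathcal{RE}_G(v_i)=|R(G)|_{ii}$, the $i$-th diagonal entry of $|R(G)|$. *)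

theory Defs
  imports "HOL-Analysis.Analysis" "Graph_Theory.Digraph_Component"
begin

text \<open>
  A finite simple graph is a value \<open>G\<close> with \<open>graph G\<close>, the undirected graphs of Graph_Theory: finite,
  loop-free, without parallel arcs, and with every edge represented by its two opposite arcs.
  So \<open>u \<rightarrow>\<^bsub>G\<^esub> w\<close> is the (symmetric) adjacency relation and the degree of a vertex is
  the number of arcs leaving it.  An enumeration of the \<open>n\<close> vertices is a bijection \<open>v\<close> from
  a finite index type with \<open>n\<close> elements onto \<open>verts G\<close>.
\<close>

definition vertex_degree :: "('a, 'b) pre_digraph \<Rightarrow> 'a \<Rightarrow> real" where
  "vertex_degree G u = real (out_degree G u)"

definition randic_matrix :: "('a, 'b) pre_digraph \<Rightarrow> ('n::finite \<Rightarrow> 'a) \<Rightarrow> real^'n^'n" where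
  "randic_matrix G v =
    (\<chi> i j. if v i \<rightarrow>\<^bsub>G\<^esub> v j then 1 / sqrt (vertex_degree G (v i) * vertex_degree G (v j)) else 0)"

definition pos_semidef :: "real^'n^'n \<Rightarrow> bool" where
  "pos_semidef A \<longleftrightarrow> transpose A = A \<and> (\<forall>x. 0 \<le> x \<bullet> (A *v x))"

text \<open>The description is proper exactly when \<open>A\<close> is positive semidefinite, as
  \<open>A ** transpose A\<close> always is.\<close>

definition matrix_sqrt :: "real^'n^'n \<Rightarrow> real^'n^'n" where
  "matrix_sqrt A = (THE B. pos_semidef B \<and> B ** B = A)"

definition matrix_abs :: "real^'n^'n \<Rightarrow> real^'n^'n" where
  "matrix_abs A = matrix_sqrt (A ** transpose A)"

definition randic_energy :: "('a, 'b) pre_digraph \<Rightarrow> ('n::finite \<Rightarrow> 'a) \<Rightarrow> 'n \<Rightarrow> real" where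
  "randic_energy G v i = matrix_abs (randic_matrix G v) $ i $ i"

end

theory Submission
  imports Defs
begin

text \<open>
  Write \<open>R\<close> for the Randic matrix and \<open>B = |R|\<close>.  The right-hand side of the theorem is
  \<open>3/8 + 3/4 (B\<^sup>2)\<^sub>i\<^sub>i - 1/8 (B\<^sup>4)\<^sub>i\<^sub>i\<close>: as \<open>B\<^sup>2 = R\<^sup>2\<close>, the two sums over the graph are the
  diagonal entry of \<open>R\<^sup>2\<close> and the squared length of the \<open>i\<close>-th row of \<open>R\<^sup>2\<close>, which is the
  diagonal entry of \<open>R\<^sup>4\<close>.  So the claim is the scalar inequality
  \<open>t \<le> 3/8 + 3/4 t\<^sup>2 - 1/8 t\<^sup>4\<close>, that is \<open>(1 - t)\<^sup>3 (3 + t) \<ge> 0\<close>, applied to the operator \<open>B\<close>;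
  it is true for \<open>0 \<le> t \<le> 1\<close>, and \<open>B\<close> satisfies \<open>0 \<le> B \<le> 1\<close> because \<open>R\<close> is a contraction.

  No diagonalisation is used.  The polynomial inequality follows from \<open>f\<^sup>2 \<le> f\<close> for
  \<open>0 \<le> f \<le> 1\<close> (lemma \<open>positive_contraction_quartic_bound\<close>).  The contraction property is the
  inequality of arithmetic and geometric means on each arc (\<open>randic_matrix_contraction\<close>).
  What remains is that \<open>|R|\<close> really is a positive semidefinite square root of \<open>R\<^sup>2\<close>, since
  its definition by a description says nothing until existence and uniqueness are known.
  Existence comes from a norm-convergent iteration in the algebra of bounded operators
  (\<open>positive_contraction_has_sqrt\<close>), uniqueness from a trace argument
  (\<open>pos_semidef_sqrt_unique\<close>).
\<close>

section \<open>Operator inequalities for positive contractions\<close>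

text \<open>
  With \<open>g = 1 - f\<close>, the identity \<open>f - f\<^sup>2 = f g (f + g) = f g f + g f g\<close> shows that \<open>f - f\<^sup>2\<close> is
  positive, both summands being conjugates of positive operators.
\<close>

lemma positive_contraction_square_le:
  fixes f :: "'a::real_inner \<Rightarrow> 'a"
  assumes lin: "linear f" and sym: "\<And>x y. x \<bullet> f y = f x \<bullet> y"
    and pos: "\<And>x. 0 \<le> x \<bullet> f x" and le: "\<And>x. x \<bullet> f x \<le> x \<bullet> x"
  shows "f x \<bullet> f x \<le> x \<bullet> f x"
proof -
  \<comment> \<open>This is the summand \<open>g f g\<close>; the summand \<open>f g f\<close> is \<open>le\<close> at \<open>f x\<close>.\<close>
  have "0 \<le> (x - f x) \<bullet> f (x - f x)" by (rule pos)
  also have "\<dots> = x \<bullet> f x - 2 * (f x \<bullet> f x) + f x \<bullet> f (f x)"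
    by (simp add: linear_diff[OF lin] inner_diff sym[of x "f x"] inner_commute[of "f x" x])
  finally show ?thesis using le[of "f x"] by linarith
qed

text \<open>
  Eight times the difference of the two sides is the quadratic form of \<open>(1 - f)\<^sup>3 (3 + f)\<close>, which
  for \<open>w = (1 - f) x\<close> is \<open>3 \<langle>w, (1 - f) w\<rangle> + \<langle>w, (f - f\<^sup>2) w\<rangle>\<close>.
\<close>

lemma positive_contraction_quartic_bound:
  fixes f :: "'a::real_inner \<Rightarrow> 'a"
  assumes lin: "linear f" and sym: "\<And>x y. x \<bullet> f y = f x \<bullet> y"
    and pos: "\<And>x. 0 \<le> x \<bullet> f x" and le: "\<And>x. x \<bullet> f x \<le> x \<bullet> x"
  shows "x \<bullet> f x \<le> 3 / 8 * (x \<bullet> x) + 3 / 4 * (f x \<bullet> f x) - 1 / 8 * (f (f x) \<bullet> f (f x))"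
proof -
  define w where "w = x - f x"
  have ww: "w \<bullet> w = x \<bullet> x - 2 * (x \<bullet> f x) + f x \<bullet> f x"
    by (simp add: w_def inner_diff inner_commute)
  have wfw: "w \<bullet> f w = x \<bullet> f x - 2 * (f x \<bullet> f x) + f x \<bullet> f (f x)"
    by (simp add: w_def linear_diff[OF lin] inner_diff sym[of x "f x"] inner_commute[of "f x" x])
  have fwfw: "f w \<bullet> f w = f x \<bullet> f x - 2 * (f x \<bullet> f (f x)) + f (f x) \<bullet> f (f x)"
    by (simp add: w_def linear_diff[OF lin] inner_diff inner_commute)
  have "f w \<bullet> f w \<le> w \<bullet> f w"
    by (rule positive_contraction_square_le[OF lin sym pos le])
  with le[of w] show ?thesis
    unfolding ww wfw fwfw by linarith
qed

section \<open>Existence of positive square roots\<close>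

text \<open>
  To find the square root of \<open>1 - C\<close>, look for it as \<open>1 - Y\<close>: then \<open>(1 - Y)\<^sup>2 = 1 - C\<close> is the
  fixed point equation \<open>Y = (C + Y\<^sup>2) / 2\<close>, which is iterated from \<open>0\<close>.
\<close>

primrec sqrt_iter :: "('a::real_normed_vector \<Rightarrow>\<^sub>L 'a) \<Rightarrow> nat \<Rightarrow> 'a \<Rightarrow>\<^sub>L 'a" where
  "sqrt_iter C 0 = 0"
| "sqrt_iter C (Suc n) = (1 / 2) *\<^sub>R (C + (sqrt_iter C n o\<^sub>L sqrt_iter C n))"

text \<open>
  The same iteration for the number \<open>1\<close> in place of \<open>C\<close>.  It controls the operator iteration
  for every \<open>C\<close> of norm at most \<open>1\<close>.  At norm \<open>1\<close> the map \<open>Y \<mapsto> (C + Y\<^sup>2) / 2\<close> need not be a strict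
  contraction of the unit ball, so convergence is inherited from this monotone bounded
  sequence and not from a fixed point theorem.
\<close>

primrec sqrt_majorant :: "nat \<Rightarrow> real" where
  "sqrt_majorant 0 = 0"
| "sqrt_majorant (Suc n) = (1 + (sqrt_majorant n)\<^sup>2) / 2"

lemma sqrt_majorant_bounds: "0 \<le> sqrt_majorant n" "sqrt_majorant n \<le> 1"
proof -
  have "0 \<le> sqrt_majorant n \<and> sqrt_majorant n \<le> 1"
    by (induction n) (auto simp: power_le_one)
  then show "0 \<le> sqrt_majorant n" "sqrt_majorant n \<le> 1" by auto
qed

lemma incseq_sqrt_majorant: "incseq sqrt_majorant"
proof (rule incseq_SucI)
  fix n
  have "0 \<le> (1 - sqrt_majorant n)\<^sup>2" by simp
  then show "sqrt_majorant n \<le> sqrt_majorant (Suc n)"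
    by (simp add: power2_diff)
qed

lemma Cauchy_sqrt_majorant: "Cauchy sqrt_majorant"
proof -
  obtain L where "sqrt_majorant \<longlonglongrightarrow> L"
    using incseq_convergent[OF incseq_sqrt_majorant] sqrt_majorant_bounds(2) by metis
  then show ?thesis by (rule LIMSEQ_imp_Cauchy)
qed

lemma norm_sqrt_iter_le:
  assumes "norm C \<le> 1"
  shows "norm (sqrt_iter C n) \<le> sqrt_majorant n"
proof (induction n)
  case (Suc n)
  let ?Y = "sqrt_iter C n"
  have "norm (?Y o\<^sub>L ?Y) \<le> norm ?Y * norm ?Y" by (rule norm_blinfun_compose)
  also have "\<dots> \<le> (sqrt_majorant n)\<^sup>2"
    unfolding power2_eq_square by (intro mult_mono Suc sqrt_majorant_bounds) auto
  finally show ?case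
    using norm_triangle_ineq[of C "?Y o\<^sub>L ?Y"] assms by simp
qed simp

text \<open>
  Two successive steps \<open>Y\<close>, \<open>Z\<close> of the iteration satisfy
  \<open>Z\<^sup>2 - Y\<^sup>2 = Z (Z - Y) + (Z - Y) Y\<close>, whose norm is at most \<open>(z + y) (z - y) = z\<^sup>2 - y\<^sup>2\<close> for the
  scalar bounds \<open>y\<close>, \<open>z\<close>.  Splitting in this order avoids any commutation of \<open>Y\<close> with \<open>Z\<close>.
\<close>

lemma norm_sqrt_iter_step_le:
  assumes "norm C \<le> 1"
  shows "norm (sqrt_iter C (Suc n) - sqrt_iter C n) \<le> sqrt_majorant (Suc n) - sqrt_majorant n"
proof (induction n)
  case 0
  then show ?case using assms by simp
next
  case (Suc n)
  let ?Y = "sqrt_iter C n" and ?Z = "sqrt_iter C (Suc n)"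
  let ?y = "sqrt_majorant n" and ?z = "sqrt_majorant (Suc n)"
  have "sqrt_iter C (Suc (Suc n)) - ?Z
      = (1 / 2) *\<^sub>R (C + (?Z o\<^sub>L ?Z)) - (1 / 2) *\<^sub>R (C + (?Y o\<^sub>L ?Y))"
    by (simp only: sqrt_iter.simps)
  also have "\<dots> = (1 / 2) *\<^sub>R ((?Z o\<^sub>L (?Z - ?Y)) + ((?Z - ?Y) o\<^sub>L ?Y))"
    by (simp del: sqrt_iter.simps add: algebra_simps bounded_bilinear.diff_left[OF bounded_bilinear_blinfun_compose]
        bounded_bilinear.diff_right[OF bounded_bilinear_blinfun_compose])
  finally have "norm (sqrt_iter C (Suc (Suc n)) - ?Z)
      = norm ((?Z o\<^sub>L (?Z - ?Y)) + ((?Z - ?Y) o\<^sub>L ?Y)) / 2" by simp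
  also have "\<dots> \<le> (norm ?Z * norm (?Z - ?Y) + norm (?Z - ?Y) * norm ?Y) / 2"
    by (intro divide_right_mono norm_triangle_mono norm_blinfun_compose) simp
  also have "\<dots> \<le> (?z * (?z - ?y) + (?z - ?y) * ?y) / 2"
    by (intro divide_right_mono add_mono mult_mono Suc norm_sqrt_iter_le assms sqrt_majorant_bounds
        order_trans[OF norm_ge_zero Suc]) auto
  also have "\<dots> = sqrt_majorant (Suc (Suc n)) - ?z"
    by (simp only: sqrt_majorant.simps(2)[of "Suc n"] sqrt_majorant.simps(2)[of n])
      (simp add: field_simps power2_eq_square)
  finally show ?case .
qed

lemma convergent_sqrt_iter:
  fixes C :: "'a::banach \<Rightarrow>\<^sub>L 'a"
  assumes "norm C \<le> 1"
  shows "convergent (sqrt_iter C)"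
proof -
  have step: "norm (sqrt_iter C (m + k) - sqrt_iter C m) \<le> sqrt_majorant (m + k) - sqrt_majorant m"
    for m k
  proof (induction k)
    case (Suc k)
    then show ?case
      using norm_sqrt_iter_step_le[OF assms, of "m + k"]
        norm_triangle_ineq[of "sqrt_iter C (Suc (m + k)) - sqrt_iter C (m + k)"
          "sqrt_iter C (m + k) - sqrt_iter C m"]
      by (simp del: sqrt_iter.simps sqrt_majorant.simps)
  qed simp
  have "dist (sqrt_iter C m) (sqrt_iter C n) \<le> dist (sqrt_majorant m) (sqrt_majorant n)" for m n
  proof (induction m n rule: linorder_wlog)
    case (le m n)
    then show ?case
      using step[of m "n - m"] by (simp add: dist_norm norm_minus_commute)
  qed (simp add: dist_commute)
  then have "Cauchy (sqrt_iter C)"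
    using Cauchy_sqrt_majorant unfolding Cauchy_def by (meson order_le_less_trans)
  then show ?thesis by (rule Cauchy_convergent)
qed

lemma sqrt_iter_symmetric:
  fixes C :: "'a::real_inner \<Rightarrow>\<^sub>L 'a"
  assumes "\<And>x y. x \<bullet> C y = C x \<bullet> y"
  shows "x \<bullet> sqrt_iter C n y = sqrt_iter C n x \<bullet> y"
proof (induction n arbitrary: x y)
  case (Suc n)
  then show ?case
    by (simp only: sqrt_iter.simps)
      (simp add: blinfun.bilinear_simps inner_add_left inner_add_right assms)
qed (simp add: blinfun.bilinear_simps)

text \<open>
  The operator \<open>C = 1 - A\<close> has norm at most \<open>1\<close>, since \<open>|C x|\<^sup>2 \<le> \<langle>x, C x\<rangle> \<le> |x|\<^sup>2\<close>.  So the iteration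
  converges to some symmetric \<open>Y\<close> of norm at most \<open>1\<close>, and \<open>1 - Y\<close> is the positive root of \<open>A\<close>.
\<close>

lemma positive_contraction_has_sqrt:
  fixes A :: "'a::{real_inner,banach} \<Rightarrow>\<^sub>L 'a"
  assumes sym: "\<And>x y. x \<bullet> A y = A x \<bullet> y"
    and pos: "\<And>x. 0 \<le> x \<bullet> A x" and le: "\<And>x. x \<bullet> A x \<le> x \<bullet> x"
  obtains B :: "'a \<Rightarrow>\<^sub>L 'a"
  where "\<And>x y. x \<bullet> B y = B x \<bullet> y" "\<And>x. 0 \<le> x \<bullet> B x" "\<And>x. B (B x) = A x"
proof -
  define C where "C = id_blinfun - A"
  have C: "C x = x - A x" for x by (simp add: C_def blinfun.bilinear_simps)
  have symC: "x \<bullet> C y = C x \<bullet> y" for x y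
    by (simp add: C inner_diff_left inner_diff_right sym)
  have normC: "norm C \<le> 1"
  proof (rule norm_blinfun_bound)
    fix x
    have "C x \<bullet> C x \<le> x \<bullet> C x"
    proof (rule positive_contraction_square_le)
      show "linear (blinfun_apply C)"
        by (rule bounded_linear.linear[OF blinfun.bounded_linear_right])
      show "0 \<le> z \<bullet> C z" "z \<bullet> C z \<le> z \<bullet> z" for z
        by (simp_all add: C inner_diff_right le pos)
    qed (rule symC)
    also have "\<dots> \<le> x \<bullet> x" by (simp add: C inner_diff_right pos)
    finally show "norm (C x) \<le> 1 * norm x" by (simp add: norm_le)
  qed simp
  obtain Y where Y: "sqrt_iter C \<longlonglongrightarrow> Y"
    using convergent_sqrt_iter[OF normC] by (auto simp: convergent_def)
  have "(\<lambda>n. sqrt_iter C (Suc n)) \<longlonglongrightarrow> (1 / 2) *\<^sub>R (C + (Y o\<^sub>L Y))"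
    unfolding sqrt_iter.simps
    by (intro tendsto_intros Y bounded_bilinear.tendsto[OF bounded_bilinear_blinfun_compose])
  then have fix_Y: "Y = (1 / 2) *\<^sub>R (C + (Y o\<^sub>L Y))"
    using LIMSEQ_Suc[OF Y] LIMSEQ_unique by blast
  have YY: "Y (Y x) = 2 *\<^sub>R Y x - C x" for x
  proof -
    have "Y x = (1 / 2) *\<^sub>R (C x + Y (Y x))"
      by (subst fix_Y) (simp add: blinfun.bilinear_simps)
    then have "2 *\<^sub>R Y x = 2 *\<^sub>R ((1 / 2) *\<^sub>R (C x + Y (Y x)))" by (rule arg_cong)
    then show ?thesis by simp
  qed
  have symY: "x \<bullet> Y y = Y x \<bullet> y" for x y
  proof (rule LIMSEQ_unique)
    show "(\<lambda>n. x \<bullet> sqrt_iter C n y) \<longlonglongrightarrow> x \<bullet> Y y"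
      by (intro tendsto_intros blinfun.tendsto Y)
    show "(\<lambda>n. x \<bullet> sqrt_iter C n y) \<longlonglongrightarrow> Y x \<bullet> y"
      unfolding sqrt_iter_symmetric[OF symC] by (intro tendsto_intros blinfun.tendsto Y)
  qed
  have normY: "norm Y \<le> 1"
    by (rule LIMSEQ_le_const2[OF tendsto_norm[OF Y]])
      (use norm_sqrt_iter_le[OF normC] sqrt_majorant_bounds(2) order_trans in blast)
  have leY: "x \<bullet> Y x \<le> x \<bullet> x" for x
  proof -
    have "x \<bullet> Y x \<le> norm x * norm (Y x)" by (rule norm_cauchy_schwarz)
    also have "norm (Y x) \<le> 1 * norm x"
      using norm_blinfun[of Y x] mult_right_mono[OF normY, of "norm x"] by simp
    finally show ?thesis by (simp add: mult_left_mono dot_square_norm power2_eq_square)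
  qed
  show thesis
  proof
    show "x \<bullet> (id_blinfun - Y) y = (id_blinfun - Y) x \<bullet> y" for x y
      by (simp add: blinfun.bilinear_simps inner_diff_left inner_diff_right symY)
    show "0 \<le> x \<bullet> (id_blinfun - Y) x" for x
      by (simp add: blinfun.bilinear_simps inner_diff_right leY)
    show "(id_blinfun - Y) ((id_blinfun - Y) x) = A x" for x
      by (simp add: blinfun.bilinear_simps YY C scaleR_2)
  qed
qed

section \<open>The modulus of a symmetric matrix\<close>

lemma symmetric_matrix_inner:
  fixes A :: "real^'n^'n"
  assumes "transpose A = A"
  shows "x \<bullet> (A *v y) = (A *v x) \<bullet> y"
  by (metis assms dot_lmul_matrix transpose_matrix_vector)

text \<open>
  If \<open>B y \<noteq> 0\<close>, then moving from \<open>y\<close> slightly in the direction \<open>- B y\<close> would make the form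
  negative.
\<close>

lemma pos_semidef_kernel:
  assumes "pos_semidef B" and "y \<bullet> (B *v y) = 0"
  shows "B *v y = 0"
proof -
  have sym: "u \<bullet> (B *v w) = (B *v u) \<bullet> w" for u w
    using assms(1) symmetric_matrix_inner unfolding pos_semidef_def by blast
  define b where "b = (B *v y) \<bullet> (B *v y)"
  define c where "c = (B *v y) \<bullet> (B *v (B *v y))"
  have c: "0 \<le> c" using assms(1) by (simp add: c_def pos_semidef_def)
  \<comment> \<open>On \<open>y - s B y\<close> the form is \<open>- 2 s b + s\<^sup>2 c\<close>.  Adding \<open>1\<close> to \<open>c\<close> in the minimising step
    \<open>b / c\<close> also covers \<open>c = 0\<close>.\<close>
  define s where "s = b / (c + 1)"
  have b: "b = s * (c + 1)" using c by (simp add: s_def)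
  have "0 \<le> (y - s *\<^sub>R (B *v y)) \<bullet> (B *v (y - s *\<^sub>R (B *v y)))"
    using assms(1) by (simp add: pos_semidef_def)
  also have "\<dots> = - 2 * s * b + s\<^sup>2 * c"
    using assms(2) sym[of y "B *v y"]
    by (simp add: matrix_vector_mult_diff_distrib matrix_vector_mult_scaleR inner_diff_left
        inner_diff_right b_def c_def power2_eq_square inner_commute algebra_simps)
  also have "\<dots> = - (s\<^sup>2 * (c + 2))"
    by (simp add: b power2_eq_square algebra_simps)
  finally have "s\<^sup>2 * (c + 2) \<le> 0" by simp
  with c have "s = 0" by (simp add: mult_le_0_iff)
  then have "b = 0" by (simp add: b)
  then show ?thesis by (simp add: b_def)
qed

lemma trace_conjugate:
  fixes B D :: "real^'n^'n"
  assumes "transpose D = D"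
  shows "trace (D ** (B ** D)) = (\<Sum>j\<in>UNIV. column j D \<bullet> (B *v column j D))"
proof -
  have "D $ j $ k = D $ k $ j" for j k
    using assms by (metis transpose_def vec_lambda_beta)
  then show ?thesis
    by (simp add: trace_def matrix_matrix_mult_def inner_vec_def matrix_vector_mult_def column_def)
qed

text \<open>
  Two roots \<open>B\<close>, \<open>C\<close> with difference \<open>D\<close> satisfy \<open>B D + D C = B\<^sup>2 - C\<^sup>2 = 0\<close>.  Multiplying by \<open>D\<close>
  and taking traces gives \<open>tr (D B D) + tr (D C D) = 0\<close>.  Both traces are sums of values of
  positive forms at the columns of \<open>D\<close>, so \<open>B\<close> and \<open>C\<close> annihilate these columns.  Then
  \<open>D\<^sup>2 = 0\<close>, and \<open>D = 0\<close> because \<open>D\<close> is symmetric.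
\<close>

lemma pos_semidef_sqrt_unique:
  fixes B C :: "real^'n^'n"
  assumes B: "pos_semidef B" and C: "pos_semidef C" and eq: "B ** B = C ** C"
  shows "B = C"
proof -
  define D where "D = B - C"
  have symD: "transpose D = D"
    using B C by (simp add: D_def pos_semidef_def transpose_def vec_eq_iff)
  have pB: "0 \<le> column j D \<bullet> (B *v column j D)" and pC: "0 \<le> column j D \<bullet> (C *v column j D)" for j
    using B C by (auto simp: pos_semidef_def)
  have "B *v (B *v x) = C *v (C *v x)" for x
    by (simp add: matrix_vector_mul_assoc eq)
  then have "B ** D + D ** C = 0"
    by (simp add: D_def matrix_eq algebra_simps flip: matrix_vector_mul_assoc)
  then have "D ** (B ** D) + D ** (D ** C) = 0"
    by (simp only: matrix_add_ldistrib[symmetric]) (simp add: matrix_matrix_mult_def vec_eq_iff)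
  moreover have "trace (D ** (D ** C)) = trace (D ** (C ** D))"
    by (metis matrix_mul_assoc trace_mul_sym)
  ultimately have "trace (D ** (B ** D)) + trace (D ** (C ** D)) = 0"
    by (metis trace_add trace_0 mat_0)
  then have "(\<Sum>j\<in>UNIV. column j D \<bullet> (B *v column j D) + column j D \<bullet> (C *v column j D)) = 0"
    by (simp add: trace_conjugate[OF symD] sum.distrib)
  then have "column j D \<bullet> (B *v column j D) + column j D \<bullet> (C *v column j D) = 0" for j
    by (subst (asm) sum_nonneg_eq_0_iff) (use pB pC in \<open>auto intro: add_nonneg_nonneg\<close>)
  then have "column j D \<bullet> (B *v column j D) = 0" "column j D \<bullet> (C *v column j D) = 0" for j
    using pB[of j] pC[of j] by (smt (verit))+
  then have "B *v column j D = 0" "C *v column j D = 0" for j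
    using pos_semidef_kernel[OF B] pos_semidef_kernel[OF C] by auto
  then have "D *v column j D = 0" for j
    unfolding D_def[THEN arg_cong[where f="\<lambda>M. M *v column j D"]]
    by (simp add: matrix_vector_mult_diff_rdistrib)
  \<comment> \<open>Column \<open>j\<close> of \<open>D\<close> is \<open>D e\<^sub>j\<close>, hence \<open>|D e\<^sub>j|\<^sup>2 = \<langle>e\<^sub>j, D (D e\<^sub>j)\<rangle>\<close>.\<close>
  then have "column j D \<bullet> column j D = 0" for j
    using symmetric_matrix_inner[OF symD, of "axis j 1" "column j D"]
    by (simp add: matrix_vector_mul_component matrix_vector_mult_basis)
  then have "D $ i $ j = 0" for i j
    by (metis column_def inner_eq_zero_iff vec_lambda_beta zero_index)
  then show ?thesis by (simp add: D_def vec_eq_iff)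
qed

text \<open>
  For a contraction \<open>R\<close> the operator \<open>R\<^sup>2\<close> lies between \<open>0\<close> and \<open>1\<close>, so its positive square root
  exists, and the description that defines \<open>|R|\<close> selects it.
\<close>

lemma matrix_abs_symmetric_contraction:
  fixes R :: "real^'n^'n"
  assumes sym: "transpose R = R" and contr: "\<And>x. norm (R *v x) \<le> norm x"
  shows "pos_semidef (matrix_abs R)" and "matrix_abs R ** matrix_abs R = R ** R"
proof -
  have inner_RR: "x \<bullet> ((R ** R) *v y) = (R *v x) \<bullet> (R *v y)" for x y
    by (simp add: symmetric_matrix_inner[OF sym] flip: matrix_vector_mul_assoc)
  define A where "A = Blinfun (\<lambda>x. (R ** R) *v x)"
  have A: "blinfun_apply A x = (R ** R) *v x" for x
    by (simp add: A_def bounded_linear_Blinfun_apply matrix_vector_mul_bounded_linear)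
  obtain S :: "(real^'n) \<Rightarrow>\<^sub>L (real^'n)" where S: "\<And>x y. x \<bullet> S y = S x \<bullet> y" "\<And>x. 0 \<le> x \<bullet> S x"
      "\<And>x. S (S x) = A x"
  proof (rule positive_contraction_has_sqrt)
    show "x \<bullet> A y = A x \<bullet> y" for x y
      by (simp add: A inner_RR inner_commute[of "(R ** R) *v x"] inner_commute[of "R *v x"])
    show "0 \<le> x \<bullet> A x" "x \<bullet> A x \<le> x \<bullet> x" for x
      using contr[of x] by (simp_all add: A inner_RR norm_le)
  qed blast
  define B where "B = matrix (blinfun_apply S)"
  have linS: "linear (blinfun_apply S)"
    by (simp add: bounded_linear.linear blinfun.bounded_linear_right)
  have B: "B *v x = S x" for x
    by (simp add: B_def linS matrix_works)
  have "transpose B = B"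
    using S(1) by (simp add: B_def transpose_def matrix_def vec_eq_iff)
      (metis cart_eq_inner_axis inner_commute)
  then have "pos_semidef B" by (simp only: pos_semidef_def B S(2) simp_thms)
  moreover have "B ** B = R ** transpose R"
    by (simp add: sym matrix_eq B S A flip: matrix_vector_mul_assoc[of B B])
  ultimately have "\<exists>!B. pos_semidef B \<and> B ** B = R ** transpose R"
    using pos_semidef_sqrt_unique by metis
  then have "pos_semidef (matrix_abs R) \<and> matrix_abs R ** matrix_abs R = R ** transpose R"
    unfolding matrix_abs_def matrix_sqrt_def by (rule theI')
  then show "pos_semidef (matrix_abs R)" and "matrix_abs R ** matrix_abs R = R ** R"
    by (simp_all add: sym)
qed

text \<open>
  The operator \<open>B = |R|\<close> satisfies \<open>|B x| = |R x| \<le> |x|\<close>, hence \<open>0 \<le> B \<le> 1\<close>, and the quartic bound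
  applies to \<open>B\<close> at the basis vector \<open>e\<^sub>i\<close>.
\<close>

lemma matrix_abs_diagonal_bound:
  fixes R :: "real^'n^'n"
  assumes sym: "transpose R = R" and contr: "\<And>x. norm (R *v x) \<le> norm x"
  shows "matrix_abs R $ i $ i
    \<le> 3 / 8 + 3 / 4 * (R ** R) $ i $ i - 1 / 8 * (\<Sum>j\<in>UNIV. ((R ** R) $ i $ j)\<^sup>2)"
proof -
  define B where "B = matrix_abs R"
  have BB: "B ** B = R ** R" and psd: "pos_semidef B"
    unfolding B_def by (rule matrix_abs_symmetric_contraction[OF sym contr])+
  then have symB: "transpose B = B" and posB: "0 \<le> x \<bullet> (B *v x)" for x
    by (auto simp: pos_semidef_def)
  note inner_B = symmetric_matrix_inner[OF symB] and inner_R = symmetric_matrix_inner[OF sym]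
  have BBv: "B *v (B *v x) = R *v (R *v x)" for x
    by (simp add: BB matrix_vector_mul_assoc)
  have "(B *v x) \<bullet> (B *v x) = (R *v x) \<bullet> (R *v x)" for x
    by (metis BBv inner_B inner_R)
  then have normB: "norm (B *v x) = norm (R *v x)" for x
    by (simp add: norm_eq)
  have leB: "x \<bullet> (B *v x) \<le> x \<bullet> x" for x
  proof -
    have "x \<bullet> (B *v x) \<le> norm x * norm (B *v x)" by (rule norm_cauchy_schwarz)
    also have "\<dots> \<le> norm x * norm x" using contr[of x] by (simp add: normB mult_left_mono)
    finally show ?thesis by (simp add: dot_square_norm power2_eq_square)
  qed
  let ?e = "axis i 1 :: real^'n"
  have comp: "?e \<bullet> (M *v ?e) = M $ i $ i" for M :: "real^'n^'n"
    by (simp add: inner_axis' matrix_vector_mult_basis column_def)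
  have "?e \<bullet> (B *v ?e) \<le> 3 / 8 * (?e \<bullet> ?e) + 3 / 4 * ((B *v ?e) \<bullet> (B *v ?e))
      - 1 / 8 * ((B *v (B *v ?e)) \<bullet> (B *v (B *v ?e)))"
    by (rule positive_contraction_quartic_bound) (rule matrix_vector_mul_linear inner_B posB leB)+
  moreover have "(B *v ?e) \<bullet> (B *v ?e) = (R ** R) $ i $ i"
    by (metis BB comp inner_B matrix_vector_mul_assoc)
  moreover have "(B *v (B *v ?e)) \<bullet> (B *v (B *v ?e)) = (\<Sum>j\<in>UNIV. ((R ** R) $ i $ j)\<^sup>2)"
  proof -
    have "R $ a $ b = R $ b $ a" for a b
      using sym by (metis transpose_def vec_lambda_beta)
    then have "(R ** R) $ j $ i = (R ** R) $ i $ j" for j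
      by (simp add: matrix_matrix_mult_def mult.commute)
    moreover have "B *v (B *v ?e) = column i (R ** R)"
      by (metis BBv matrix_vector_mul_assoc matrix_vector_mult_basis)
    ultimately show ?thesis
      by (simp add: inner_vec_def column_def power2_eq_square)
  qed
  ultimately show ?thesis
    by (simp add: comp B_def inner_axis_axis)
qed

section \<open>The Randic matrix\<close>

lemma card_neighbours_le_vertex_degree:
  assumes "fin_digraph G" and "inj v"
  shows "real (card {j. u \<rightarrow>\<^bsub>G\<^esub> v j}) \<le> vertex_degree G u"
proof -
  interpret fin_digraph G by fact
  have "card {j. u \<rightarrow>\<^bsub>G\<^esub> v j} = card (v ` {j. u \<rightarrow>\<^bsub>G\<^esub> v j})"
    using assms(2) by (simp add: card_image inj_on_subset)
  also have "\<dots> \<le> card (head G ` out_arcs G u)"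
    by (intro card_mono) (auto simp: arcs_ends_conv out_arcs_def)
  also have "\<dots> \<le> card (out_arcs G u)" by (intro card_image_le) (simp add: out_arcs_def)
  finally show ?thesis by (simp add: vertex_degree_def out_degree_def)
qed

text \<open>
  For all \<open>x\<close> and \<open>y\<close>, the inequality \<open>2 (x\<^sub>i / \<surd>d\<^sub>i) (y\<^sub>j / \<surd>d\<^sub>j) \<le> x\<^sub>i\<^sup>2 / d\<^sub>i + y\<^sub>j\<^sup>2 / d\<^sub>j\<close> summed over the arcs
  gives \<open>2 \<langle>x, R y\<rangle> \<le> |x|\<^sup>2 + |y|\<^sup>2\<close>, because a vertex has at most \<open>d\<^sub>i\<close> neighbours.  The choice
  \<open>x = R y\<close> turns this into \<open>|R y|\<^sup>2 \<le> |y|\<^sup>2\<close>.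
\<close>

lemma randic_matrix_contraction:
  fixes v :: "'n::finite \<Rightarrow> 'a"
  assumes "graph G" and "inj v"
  shows "norm (randic_matrix G v *v y) \<le> norm y"
proof -
  interpret graph G by fact
  let ?R = "randic_matrix G v"
  let ?d = "\<lambda>i. vertex_degree G (v i)"
  have d0: "0 \<le> ?d i" for i by (simp add: vertex_degree_def)
  define N where "N i j \<longleftrightarrow> v i \<rightarrow>\<^bsub>G\<^esub> v j" for i j
  have Nsym: "N i j \<longleftrightarrow> N j i" for i j using graph_symmetric by (auto simp: N_def)
  have row: "(\<Sum>j\<in>UNIV. if N i j then a / ?d i else 0) \<le> a" if "0 \<le> a" for i and a :: real
  proof -
    have "(\<Sum>j\<in>UNIV. if N i j then a / ?d i else 0) = real (card {j. N i j}) * (a / ?d i)"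
      by (simp add: sum.If_cases)
    also have "\<dots> \<le> ?d i * (a / ?d i)"
      using card_neighbours_le_vertex_degree[OF fin_digraph_axioms assms(2), of "v i"] that d0
      unfolding N_def by (intro mult_right_mono) auto
    \<comment> \<open>Strict when \<open>d\<^sub>i = 0\<close> and \<open>a > 0\<close>, as the quotient is then \<open>0\<close>.\<close>
    also have "\<dots> \<le> a" using that by simp
    finally show ?thesis .
  qed
  have entry: "s * ?R $ i $ j * t \<le> ((if N i j then s\<^sup>2 / ?d i else 0) + (if N j i then t\<^sup>2 / ?d j else 0)) / 2"
    for i j and s t :: real
  proof (cases "N i j")
    case True
    have "2 * ((s / sqrt (?d i)) * (t / sqrt (?d j))) \<le> (s / sqrt (?d i))\<^sup>2 + (t / sqrt (?d j))\<^sup>2"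
      using sum_squares_bound[of "s / sqrt (?d i)" "t / sqrt (?d j)"] by (simp only: mult.assoc)
    then show ?thesis
      using True Nsym[of i j] d0 
      by (simp add: randic_matrix_def N_def real_sqrt_mult power_divide mult.commute mult.left_commute)
  qed (simp add: randic_matrix_def N_def Nsym[of i j, unfolded N_def])
  let ?x = "?R *v y"
  have "?x \<bullet> ?x = (\<Sum>i\<in>UNIV. \<Sum>j\<in>UNIV. ?x $ i * ?R $ i $ j * y $ j)"
    by (simp add: inner_vec_def matrix_vector_mult_def sum_distrib_left mult.assoc)
  also have "\<dots> \<le> (\<Sum>i\<in>UNIV. \<Sum>j\<in>UNIV.
      ((if N i j then (?x $ i)\<^sup>2 / ?d i else 0) + (if N j i then (y $ j)\<^sup>2 / ?d j else 0)) / 2)"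
    by (intro sum_mono entry)
  also have "\<dots> = ((\<Sum>i\<in>UNIV. \<Sum>j\<in>UNIV. if N i j then (?x $ i)\<^sup>2 / ?d i else 0)
      + (\<Sum>j\<in>UNIV. \<Sum>i\<in>UNIV. if N j i then (y $ j)\<^sup>2 / ?d j else 0)) / 2"
    by (simp only: sum_divide_distrib[symmetric] sum.distrib
        sum.swap[of "\<lambda>i j. if N j i then (y $ j)\<^sup>2 / ?d j else 0"])
  also have "\<dots> \<le> ((\<Sum>i\<in>UNIV. (?x $ i)\<^sup>2) + (\<Sum>j\<in>UNIV. (y $ j)\<^sup>2)) / 2"
    by (intro divide_right_mono add_mono sum_mono row) auto
  also have "\<dots> = (?x \<bullet> ?x + y \<bullet> y) / 2"
    by (simp add: inner_vec_def power2_eq_square)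
  finally show ?thesis by (simp add: norm_le)
qed

lemma randic_matrix_square_entry:
  fixes v :: "'n::finite \<Rightarrow> 'a"
  assumes "graph G"
  shows "(randic_matrix G v ** randic_matrix G v) $ i $ j
    = 1 / sqrt (vertex_degree G (v i) * vertex_degree G (v j))
      * (\<Sum>k | v k \<rightarrow>\<^bsub>G\<^esub> v i \<and> v k \<rightarrow>\<^bsub>G\<^esub> v j. 1 / vertex_degree G (v k))"
proof -
  interpret graph G by fact
  let ?d = "\<lambda>i. vertex_degree G (v i)"
  have "randic_matrix G v $ i $ k * randic_matrix G v $ k $ j
      = (if v k \<rightarrow>\<^bsub>G\<^esub> v i \<and> v k \<rightarrow>\<^bsub>G\<^esub> v j then 1 / sqrt (?d i * ?d j) * (1 / ?d k) else 0)" for k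
    using graph_symmetric[of "v i" "v k"] graph_symmetric[of "v k" "v i"]
    by (auto simp: randic_matrix_def real_sqrt_mult vertex_degree_def)
  then show ?thesis
    by (simp add: matrix_matrix_mult_def sum.If_cases sum_distrib_left)
qed

theorem proposition3p2:
  fixes G :: "('a, 'b) pre_digraph" and v :: "'n::finite \<Rightarrow> 'a" and i :: 'n
  assumes "graph G" and "Digraph_Component.connected G" and "card (verts G) \<ge> 2"
    and "bij_betw v UNIV (verts G)"
  shows "randic_energy G v i \<le>
    3 / 8 + 3 / 4 * (1 / vertex_degree G (v i)) * (\<Sum>j | v j \<rightarrow>\<^bsub>G\<^esub> v i. 1 / vertex_degree G (v j))
      - 1 / 8 * (\<Sum>j\<in>UNIV. 1 / (vertex_degree G (v i) * vertex_degree G (v j)) *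
          (\<Sum>k | v k \<rightarrow>\<^bsub>G\<^esub> v i \<and> v k \<rightarrow>\<^bsub>G\<^esub> v j. 1 / vertex_degree G (v k))\<^sup>2)"
proof -
  interpret graph G by fact
  let ?R = "randic_matrix G v"
  have inj: "inj v" using assms(4) by (simp add: bij_betw_def)
  have d0: "0 \<le> vertex_degree G u" for u by (simp add: vertex_degree_def)
  have sym: "transpose ?R = ?R"
    using graph_symmetric by (auto simp: randic_matrix_def transpose_def vec_eq_iff mult.commute)
  have diag: "(?R ** ?R) $ i $ i
      = 1 / vertex_degree G (v i) * (\<Sum>j | v j \<rightarrow>\<^bsub>G\<^esub> v i. 1 / vertex_degree G (v j))"
    by (simp add: randic_matrix_square_entry[OF assms(1)] d0)
  have "((?R ** ?R) $ i $ j)\<^sup>2 = 1 / (vertex_degree G (v i) * vertex_degree G (v j)) *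
          (\<Sum>k | v k \<rightarrow>\<^bsub>G\<^esub> v i \<and> v k \<rightarrow>\<^bsub>G\<^esub> v j. 1 / vertex_degree G (v k))\<^sup>2" for j
    by (simp add: randic_matrix_square_entry[OF assms(1)] d0 power_mult_distrib power_divide)
  with diag show ?thesis
    using matrix_abs_diagonal_bound[OF sym randic_matrix_contraction[OF assms(1) inj], of i]
    by (simp add: randic_energy_def mult.assoc)
qed

end
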